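(* Let $n\ge 2$ be an integer. Then the number of couples $(u,v)$ of snakeshapes of size $n$ such that $\mathcal N_{u,v}=0$ is the $(n-2)$-th Fibonacci number, i.e. the number of snakeshapes of size $n-2$.
   Context: A snakeshape of size $n$ is a word $u=u_1u_2\cdots u_k$ with letters in $\{1,2\}$ and $u_1+\cdots+u_k=n$ (the empty word $\emptyset$ for $n=0$); its length is $\ell(u)=k$. It is drawn as $k$ bottom-justified columns, read from left to right, the $i$-th column having $u_i$ boxes. In a single-boxed column the unique box is both bottom and top box. The $m$-th Fibonacci number is the number of snakeshapes of size $m$ (compositions of $m$ with parts equal to $1$ or $2$), so the $0$-th and the first are both equal to $1$. A semi-standard Young-Fibonacci tableau is a numbering of the boxes of a snakeshape with nonnegative integers, not necessarily distinct, such that: (1) in each two-boxed column the top entry is strictly larger than the bottom entry; (2) the entry in the top box of any column (in particular the entry of any single-boxed column) has no entry strictly greater than itself in the columns to its right. For two snakeshapes $u,v$ of size $n$, the Young-Fibonacci number $\mathcal N_{u,v}$ is the number of distinct semi-standard Young-Fibonacci tableaux of shape $u$ and valuation $v$, that is, having exactly $v_i$ entries equal to $i$ for $i=1,\dots,\ell(v)$. *)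

theory Defs
  imports "HOL-Library.FuncSet" "HOL-Number_Theory.Fib"
begin

definition snakeshapes :: "nat \<Rightarrow> nat list set" where
  "snakeshapes n = {u. set u \<subseteq> {1, 2} \<and> sum_list u = n}"

text \<open>Indexed as in \<open>F\<^sub>0 = F\<^sub>1 = 1\<close>, i.e. shifted by one with respect to the library's
  \<^const>\<open>fib\<close>; see \<open>fibonacci_number_eq_fib\<close> below.\<close>

definition fibonacci_number :: "nat \<Rightarrow> nat" where
  "fibonacci_number m = card (snakeshapes m)"

text \<open>Letters and columns are numbered from 1, whereas list positions start at 0.\<close>

definition letter :: "nat list \<Rightarrow> nat \<Rightarrow> nat" where
  "letter u i = u ! (i - 1)"

text \<open>The box \<open>(i, j)\<close> is the \<open>j\<close>-th box from the bottom in the \<open>i\<close>-th column from the left;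
  the top box of column \<open>i\<close> is therefore \<open>(i, letter u i)\<close>.\<close>

definition boxes :: "nat list \<Rightarrow> (nat \<times> nat) set" where
  "boxes u = (SIGMA i : {1..length u}. {1..letter u i})"

text \<open>Numberings are extensional functions (\<^const>\<open>undefined\<close> outside the boxes), so that
  distinct functions are distinct numberings and counting them is meaningful.\<close>

definition ssyft :: "nat list \<Rightarrow> (nat \<times> nat \<Rightarrow> nat) set" where
  "ssyft u = {T \<in> boxes u \<rightarrow>\<^sub>E (UNIV :: nat set).
     (\<forall>i \<in> {1..length u}. letter u i = 2 \<longrightarrow> T (i, 1) < T (i, 2)) \<and>
     (\<forall>i \<in> {1..length u}. \<forall>(i', j) \<in> boxes u.
        i < i' \<longrightarrow> \<not> T (i', j) > T (i, letter u i))}"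

definition has_valuation :: "nat list \<Rightarrow> nat list \<Rightarrow> (nat \<times> nat \<Rightarrow> nat) \<Rightarrow> bool" where
  "has_valuation u v T \<longleftrightarrow>
     (\<forall>i \<in> {1..length v}. card {b \<in> boxes u. T b = i} = letter v i)"

definition young_fibonacci_number :: "nat list \<Rightarrow> nat list \<Rightarrow> nat" where
  "young_fibonacci_number u v = card {T \<in> ssyft u. has_valuation u v T}"

text \<open>The remaining facts validate the definitions: no cardinality above is that of an infinite
  set when both shapes have the same size.\<close>

lemma snakeshapes_0: "snakeshapes 0 = {[]}"
proof (rule set_eqI)
  fix u
  show "u \<in> snakeshapes 0 \<longleftrightarrow> u \<in> {[]}"
    by (cases u) (auto simp: snakeshapes_def)
qed

lemma snakeshapes_1: "snakeshapes (Suc 0) = {[1]}"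
proof (rule set_eqI)
  fix u
  show "u \<in> snakeshapes (Suc 0) \<longleftrightarrow> u \<in> {[1]}"
  proof (cases u)
    case (Cons a w)
    show ?thesis
      by (cases w) (auto simp: Cons snakeshapes_def)
  qed (simp add: snakeshapes_def)
qed

lemma snakeshapes_Suc_Suc:
  "snakeshapes (Suc (Suc n)) = (#) 1 ` snakeshapes (Suc n) \<union> (#) 2 ` snakeshapes n"
proof (rule set_eqI)
  fix u
  show "u \<in> snakeshapes (Suc (Suc n)) \<longleftrightarrow>
    u \<in> (#) 1 ` snakeshapes (Suc n) \<union> (#) 2 ` snakeshapes n"
    by (cases u) (auto simp: snakeshapes_def)
qed

lemma finite_snakeshapes: "finite (snakeshapes n)"
  by (induction n rule: fib.induct)
     (simp_all add: snakeshapes_0 snakeshapes_1[simplified] snakeshapes_Suc_Suc)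

lemma fibonacci_number_eq_fib: "fibonacci_number m = fib (Suc m)"
proof (induction m rule: fib.induct)
  case (3 n)
  have "card (snakeshapes (Suc (Suc n))) = card (snakeshapes (Suc n)) + card (snakeshapes n)"
    unfolding snakeshapes_Suc_Suc
    by (subst card_Un_disjoint) (auto simp: finite_snakeshapes card_image)
  with 3 show ?case by (simp add: fibonacci_number_def)
qed (simp_all add: fibonacci_number_def snakeshapes_0 snakeshapes_1[simplified])

lemma finite_boxes: "finite (boxes u)"
  by (simp add: boxes_def)

lemma sum_letter: "(\<Sum>i = 1..length u. letter u i) = sum_list u"
proof -
  have "(\<Sum>i = 1..length u. letter u i) = (\<Sum>i = 0..<length u. u ! i)"
    by (rule sum.reindex_bij_witness[of _ Suc "\<lambda>i. i - 1"]) (auto simp: letter_def)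
  then show ?thesis by (simp add: sum_list_sum_nth)
qed

lemma card_boxes: "card (boxes u) = sum_list u"
  by (simp add: boxes_def sum_letter[simplified])

lemma valuation_range:
  assumes "sum_list u = sum_list v" "has_valuation u v T" "b \<in> boxes u"
  shows "T b \<in> {1..length v}"
proof -
  let ?B = "\<lambda>i. {b \<in> boxes u. T b = i}"
  have fin: "finite (?B i)" for i by (simp add: finite_boxes)
  have "card (\<Union>i\<in>{1..length v}. ?B i) = (\<Sum>i = 1..length v. card (?B i))"
    by (rule card_UN_disjoint) (use fin in auto)
  also have "\<dots> = (\<Sum>i = 1..length v. letter v i)"
    using assms(2) by (intro sum.cong) (auto simp: has_valuation_def)
  also have "\<dots> = card (boxes u)" using assms(1) by (simp only: sum_letter card_boxes)
  finally have "(\<Union>i\<in>{1..length v}. ?B i) = boxes u"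
    by (intro card_subset_eq finite_boxes) auto
  with assms(3) show ?thesis by auto
qed

lemma finite_tableaux:
  assumes "u \<in> snakeshapes n" "v \<in> snakeshapes n"
  shows "finite {T \<in> ssyft u. has_valuation u v T}"
proof (rule finite_subset)
  show "{T \<in> ssyft u. has_valuation u v T} \<subseteq> boxes u \<rightarrow>\<^sub>E {1..length v}"
  proof
    fix T assume T: "T \<in> {T \<in> ssyft u. has_valuation u v T}"
    have "sum_list u = sum_list v" using assms by (simp add: snakeshapes_def)
    then have "T b \<in> {1..length v}" if "b \<in> boxes u" for b
      using valuation_range T that by blast
    with T show "T \<in> boxes u \<rightarrow>\<^sub>E {1..length v}"
      by (auto simp: ssyft_def PiE_def)
  qed
  show "finite (boxes u \<rightarrow>\<^sub>E {1..length v})"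
    by (intro finite_PiE finite_boxes) auto
qed

end

theory Submission
  imports Defs "HOL-Library.Multiset"
begin

text \<open>\<open>\<N>\<^bsub>u,v\<^esub>\<close> vanishes exactly when \<open>u = 1\<dots>12\<close> and \<open>v\<close> begins with \<open>2\<close>. In that case the
  bottom entry of the last column is the only one that can equal \<open>1\<close>. Otherwise one fills the columns
  greedily from the left: each top entry is the largest remaining value, and since no value occurs
  more than twice, a smaller partner for a two-boxed column can only be missing in the last column.
  There it is present if the smallest value is left only once on arrival: if there is an
  earlier two-boxed column, the bottom entry of the last such column can be chosen to ensure it, and
  otherwise \<open>v\<close> begins with \<open>1\<close>.\<close>

section \<open>Contents of tableaux, and adding a column on the left\<close>

text \<open>As a multiset, the entries split into those of the first column and those of the rest,
  which suits an induction over the columns; \<open>has_valuation\<close> only prescribes the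
  multiplicities of the values from 1 to \<open>length v\<close>.\<close>

definition content :: "nat list \<Rightarrow> (nat \<times> nat \<Rightarrow> nat) \<Rightarrow> nat multiset" where
  "content u T = image_mset T (mset_set (boxes u))"

lemma count_content: "count (content u T) x = card {b \<in> boxes u. T b = x}"
proof -
  have "{b \<in> boxes u. T b = x} = T -` {x} \<inter> boxes u" by auto
  then show ?thesis
    by (simp add: content_def count_image_mset finite_boxes)
qed

lemma boxes_Cons: "boxes (a # u) = Pair 1 ` {1..a} \<union> map_prod Suc id ` boxes u"
proof (rule set_eqI)
  fix b :: "nat \<times> nat"
  obtain i j where b: "b = (i, j)" by (cases b)
  show "b \<in> boxes (a # u) \<longleftrightarrow> b \<in> Pair 1 ` {1..a} \<union> map_prod Suc id ` boxes u"
  proof (cases i)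
    case 0
    then show ?thesis by (auto simp: b boxes_def)
  next
    case (Suc i')
    show ?thesis
      by (cases i') (auto simp: b Suc boxes_def letter_def image_iff Bex_def)
  qed
qed

text \<open>Condition (2) looks only to the right, so the columns of \<open>u\<close> keep their
  conditions and only the new column adds some: \<open>strict\<close> and \<open>top\<close>. As 0
  is not a letter of \<open>u\<close>, the top position of each of its columns is a box, where the
  shifted numbering agrees with \<open>T\<close>.\<close>

lemma ssyft_Cons:
  fixes f :: "nat \<Rightarrow> nat"
  assumes T: "T \<in> ssyft u" and u: "0 \<notin> set u" and a: "1 \<le> a"
    and strict: "a = 2 \<Longrightarrow> f 1 < f 2" and top: "\<forall>x \<in># content u T. x \<le> f a"
  shows "\<exists>T' \<in> ssyft (a # u). content (a # u) T' = image_mset f (mset_set {1..a}) + content u T"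
proof -
  define g where "g = (\<lambda>(i, j). if i = 1 then f j else T (i - 1, j))"
  \<comment> \<open>The restriction makes the numbering extensional, as membership in
    \<open>ssyft\<close> demands.\<close>
  define T' where "T' = restrict g (boxes (a # u))"
  have T'1: "T' (1, j) = f j" if "j \<in> {1..a}" for j
    using that by (auto simp: T'_def g_def boxes_Cons)
  have pos: "1 \<le> i" if "(i, j) \<in> boxes u" for i j
    using that by (auto simp: boxes_def)
  have T'Suc: "T' (Suc i, j) = T (i, j)" if "(i, j) \<in> boxes u" for i j
    using that pos[OF that] by (force simp: T'_def g_def boxes_Cons)
  have le: "T b \<le> f a" if "b \<in> boxes u" for b
    using top that by (auto simp: content_def finite_boxes)
  have letter_1: "letter (a # u) 1 = a" by (simp add: letter_def)
  have letter_Suc: "letter (a # u) (Suc i) = letter u i" if "1 \<le> i" for i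
    using that by (auto simp: letter_def)
  have "T' \<in> ssyft (a # u)"
    unfolding ssyft_def
  proof (intro CollectI conjI ballI)
    show "T' \<in> boxes (a # u) \<rightarrow>\<^sub>E UNIV" by (auto simp: T'_def)
  next
    fix i assume i: "i \<in> {1..length (a # u)}"
    show "letter (a # u) i = 2 \<longrightarrow> T' (i, 1) < T' (i, 2)"
    proof (cases "i = 1")
      case True
      with strict show ?thesis using T'1[of 1] T'1[of 2] letter_1 by auto
    next
      case False
      with i obtain k where k: "i = Suc k" "k \<in> {1..length u}"
        by (cases i) auto
      show ?thesis
      proof
        assume "letter (a # u) i = 2"
        then have "letter u k = 2" using k letter_Suc by auto
        with T k have "T (k, 1) < T (k, 2)" by (auto simp: ssyft_def)
        moreover have "(k, 1) \<in> boxes u" "(k, 2) \<in> boxes u"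
          using k \<open>letter u k = 2\<close> by (auto simp: boxes_def)
        ultimately show "T' (i, 1) < T' (i, 2)" using T'Suc k by simp
      qed
    qed
  next
    fix i b assume i: "i \<in> {1..length (a # u)}" and b: "b \<in> boxes (a # u)"
    obtain i' j where ij: "b = (i', j)" by (cases b)
    have "\<not> T' (i, letter (a # u) i) < T' (i', j)" if lt: "i < i'"
    proof -
      from i lt obtain k' where k': "i' = Suc k'" "1 \<le> k'" by (cases i') auto
      with b have bk: "(k', j) \<in> boxes u" by (auto simp: ij boxes_Cons)
      show ?thesis
      proof (cases "i = 1")
        case True
        then show ?thesis using le[OF bk] T'Suc[OF bk] T'1[of a] a letter_1 k' by auto
      next
        case False
        with i obtain k where k: "i = Suc k" "k \<in> {1..length u}"
          by (cases i) auto
        with T bk lt k' have *: "\<not> T (k, letter u k) < T (k', j)"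
          by (fastforce simp: ssyft_def)
        have "letter u k \<in> set u" using k by (auto simp: letter_def)
        with u have "letter u k \<noteq> 0" by metis
        then have "(k, letter u k) \<in> boxes u" using k by (auto simp: boxes_def)
        with * show ?thesis using T'Suc bk k k' letter_Suc by auto
      qed
    qed
    then show "case b of (i', j) \<Rightarrow> i < i' \<longrightarrow> \<not> T' (i, letter (a # u) i) < T' (i', j)"
      by (simp add: ij)
  qed
  moreover have "content (a # u) T' = image_mset f (mset_set {1..a}) + content u T"
  proof -
    \<comment> \<open>The union is disjoint: the columns of \<open>u\<close> start at 1, hence at 2
      after the shift.\<close>
    have "mset_set (boxes (a # u)) =
        mset_set (Pair 1 ` {1..a}) + mset_set (map_prod Suc id ` boxes u)"
      unfolding boxes_Cons
      by (rule mset_set_Union) (use pos in \<open>force simp: finite_boxes\<close>)+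
    also have "mset_set (Pair 1 ` {1..a}) = image_mset (Pair 1) (mset_set {1..a})"
      by (rule image_mset_mset_set[symmetric]) (auto simp: inj_on_def)
    also have "mset_set (map_prod Suc id ` boxes u) =
        image_mset (map_prod Suc id) (mset_set (boxes u))"
      by (rule image_mset_mset_set[symmetric]) (auto simp: inj_on_def)
    finally have eq: "mset_set (boxes (a # u)) = image_mset (Pair 1) (mset_set {1..a}) +
        image_mset (map_prod Suc id) (mset_set (boxes u))" .
    have "image_mset (\<lambda>j. T' (1, j)) (mset_set {1..a}) = image_mset f (mset_set {1..a})"
      by (rule image_mset_cong) (use T'1 in auto)
    moreover have "image_mset (\<lambda>b. T' (map_prod Suc id b)) (mset_set (boxes u)) =
        image_mset T (mset_set (boxes u))"
      by (rule image_mset_cong) (use T'Suc in \<open>auto simp: finite_boxes\<close>)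
    ultimately show ?thesis
      unfolding content_def eq by (simp add: multiset.map_comp comp_def)
  qed
  ultimately show ?thesis by blast
qed

section \<open>Greedy filling with a prescribed content\<close>

text \<open>If every entry of \<open>S\<close> lay in \<open>A\<close>, the multiplicities over
  \<open>A\<close> would add up to the size of \<open>S\<close>.\<close>

lemma exists_value_outside:
  assumes "finite A" "(\<Sum>x\<in>A. count S x) < size S"
  obtains z where "z \<in># S" "z \<notin> A"
proof (rule ccontr)
  assume "\<not> thesis"
  with that have "set_mset S \<subseteq> A" by blast
  then have "size S \<le> (\<Sum>z\<in>A. count S z)"
    unfolding size_multiset_overloaded_eq using assms(1) by (intro sum_mono2) auto
  with assms(2) show False by simp
qed

text \<open>Induction on \<open>u\<close>: the maximum of \<open>S\<close> in the top box of the
  first column settles condition (2) there, and the rest of \<open>S\<close> is passed on. The last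
  hypothesis excludes a repeated minimum for the shapes 1...12; the work lies in preserving
  it.\<close>

lemma exists_tableau_with_content:
  assumes "set u \<subseteq> {1, 2}" "size S = sum_list u" "\<And>x. count S x \<le> 2"
    and "\<And>k. u = replicate k 1 @ [2] \<Longrightarrow> count S (Min (set_mset S)) \<noteq> 2"
  shows "\<exists>T \<in> ssyft u. content u T = S"
  using assms
proof (induction u arbitrary: S)
  case Nil
  have "(\<lambda>_. undefined) \<in> ssyft []" by (simp add: ssyft_def boxes_def)
  moreover have "content [] (\<lambda>_. undefined) = S"
    using Nil by (simp add: content_def boxes_def)
  ultimately show ?case by blast
next
  case (Cons a u)
  from Cons.prems have "S \<noteq> {#}" by auto
  define M where "M = Max (set_mset S)"
  define m where "m = Min (set_mset S)"
  have M: "M \<in># S" "\<And>x. x \<in># S \<Longrightarrow> x \<le> M"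
    using \<open>S \<noteq> {#}\<close> by (auto simp: M_def)
  have m: "m \<in># S" "\<And>x. x \<in># S \<Longrightarrow> m \<le> x"
    using \<open>S \<noteq> {#}\<close> by (auto simp: m_def)
  have Min_eq: "Min (set_mset R) = m" if "m \<in># R" "R \<subseteq># S" for R
    using that m(2) by (intro Min_eqI) (auto dest: mset_subset_eqD)
  have mM: "m < M" if "count S m < size S"
  proof -
    obtain z where "z \<in># S" "z \<noteq> m"
      using exists_value_outside[of "{m}" S] \<open>count S m < size S\<close> by auto
    with M(2)[of z] m(2)[of z] show ?thesis by linarith
  qed
  \<comment> \<open>Three entries with multiplicities at most 2 cannot all be equal.\<close>
  have mM3: "m < M" if "size S \<ge> 3"
    using mM that Cons.prems(3)[of m] by linarith
  have u: "set u \<subseteq> {1, 2}" using Cons.prems by auto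
  from Cons.prems have "a = 1 \<or> a = 2" by auto
  then show ?case
  proof
    assume a: "a = 1"
    obtain R where R: "S = add_mset M R" using M(1) by (metis mset_add)
    have "\<exists>T \<in> ssyft u. content u T = R"
    proof (rule Cons.IH[OF u])
      show "size R = sum_list u" using Cons.prems R a by simp
      show "count R x \<le> 2" for x
        using Cons.prems(3)[of x] by (simp add: R split: if_splits)
      fix k assume k: "u = replicate k 1 @ [2]"
      with Cons.prems a have "size S \<ge> 3" by (simp add: sum_list_replicate)
      with mM3 have "m < M" by blast
      moreover from this have "m \<in># R" using m(1) R by auto
      \<comment> \<open>Prepending 1 to a shape 1...12 gives another such shape, so the hypothesis
        on \<open>S\<close> applies; removing \<open>M\<close>, which exceeds \<open>m\<close>,
        keeps the multiplicity of \<open>m\<close>.\<close>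
      moreover have "count S m \<noteq> 2"
        using Cons.prems(4)[of "Suc k"] a k by (simp add: m_def)
      ultimately show "count R (Min (set_mset R)) \<noteq> 2"
        using Min_eq[of R] R by auto
    qed
    then obtain T where T: "T \<in> ssyft u" "content u T = R" by blast
    have "\<exists>T' \<in> ssyft (1 # u). content (1 # u) T'
        = image_mset (\<lambda>_. M) (mset_set {1..1::nat}) + content u T"
      by (rule ssyft_Cons) (use T M R u in auto)
    then show ?thesis using T R a by simp
  next
    assume a: "a = 2"
    \<comment> \<open>The bottom entry \<open>b\<close> must lie below \<open>M\<close> and, if the
      remaining columns form 1...12, must not leave a repeated minimum.\<close>
    have "\<exists>b. b \<in># S \<and> b < M \<and> (\<forall>R k. S = add_mset M (add_mset b R) \<longrightarrow>
        u = replicate k 1 @ [2] \<longrightarrow> count R (Min (set_mset R)) \<noteq> 2)"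
    proof (cases "\<exists>k. u = replicate k 1 @ [2]")
      case False
      have "m < M"
      proof (cases "u = []")
        case True
        \<comment> \<open>The shape [2] is the exceptional shape with \<open>k = 0\<close>, so the
          two entries of \<open>S\<close> differ.\<close>
        with Cons.prems(4)[of 0] a Cons.prems(3)[of m] Cons.prems(2) show ?thesis
          by (intro mM) (simp add: m_def)
      next
        case False
        with u obtain c w where "u = c # w" "c \<ge> 1" by (cases u) auto
        with Cons.prems(2) a show ?thesis by (intro mM3) simp
      qed
      with False m(1) show ?thesis by blast
    next
      case True
      with Cons.prems(2) a have size: "size S \<ge> 4" by (auto simp: sum_list_replicate)
      then have "m < M" using mM3 by simp
      have pos: "1 \<le> count S m" using m(1) by simp
      \<comment> \<open>If \<open>m\<close> occurs twice, \<open>b = m\<close> leaves one copy. If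
        it occurs once, \<open>m\<close> and \<open>M\<close> account for at most 3 of at least 4
        entries, so a value strictly between them serves as \<open>b\<close> and spares
        \<open>m\<close>.\<close>
      obtain b where b: "b \<in># S" "b < M" "b = m \<longleftrightarrow> count S m = 2"
      proof (cases "count S m = 2")
        case True
        with that[of m] m(1) \<open>m < M\<close> show ?thesis by blast
      next
        case False
        with Cons.prems(3)[of m] have "count S m \<le> 1" by linarith
        with Cons.prems(3)[of M] \<open>m < M\<close> size obtain b where "b \<in># S" "b \<notin> {m, M}"
          using exists_value_outside[of "{m, M}" S] by auto
        with that[of b] M(2)[of b] False show ?thesis by auto
      qed
      have "count R (Min (set_mset R)) \<noteq> 2" if R: "S = add_mset M (add_mset b R)" for R
      proof -
        have "count S m = count R m + (if b = m then 1 else 0)" using \<open>m < M\<close> by (simp add: R)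
        with b(3) pos Cons.prems(3)[of m] have "count R m = 1" by presburger
        moreover from this have "m \<in># R" using count_inI by force
        ultimately show ?thesis using Min_eq[of R] by (simp add: R)
      qed
      with b show ?thesis by blast
    qed
    then obtain b where b: "b \<in># S" "b < M"
      and good: "\<And>R k. S = add_mset M (add_mset b R) \<Longrightarrow> u = replicate k 1 @ [2] \<Longrightarrow>
        count R (Min (set_mset R)) \<noteq> 2"
      by blast
    obtain R where R: "S = add_mset M (add_mset b R)"
      using M(1) b by (metis insert_noteq_member mset_add nat_neq_iff)
    have "\<exists>T \<in> ssyft u. content u T = R"
    proof (rule Cons.IH[OF u])
      show "size R = sum_list u" using Cons.prems R a by simp
      show "count R x \<le> 2" for x
        using Cons.prems(3)[of x] by (simp add: R split: if_splits)
    qed (rule good[OF R])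
    then obtain T where T: "T \<in> ssyft u" "content u T = R" by blast
    let ?f = "\<lambda>j::nat. if j = 1 then b else M"
    have "\<exists>T' \<in> ssyft (2 # u). content (2 # u) T'
        = image_mset ?f (mset_set {1..2}) + content u T"
      by (rule ssyft_Cons) (use T M R u b in auto)
    moreover have "{1..2} = {1, 2::nat}" by auto
    then have "image_mset ?f (mset_set {1..2}) = {#M, b#}" by simp
    ultimately show ?thesis using T R a by (simp add: add_mset_commute)
  qed
qed

section \<open>Valuations as multisets, and the criterion for vanishing\<close>

definition valuation_mset :: "nat list \<Rightarrow> nat multiset" where
  "valuation_mset v = (\<Sum>i = 1..length v. replicate_mset (letter v i) i)"

lemma count_valuation_mset:
  "count (valuation_mset v) x = (if x \<in> {1..length v} then letter v x else 0)"
  by (simp add: valuation_mset_def count_sum)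

lemma size_valuation_mset: "size (valuation_mset v) = sum_list v"
  by (simp add: valuation_mset_def sum_letter[simplified])

lemma Min_valuation_mset:
  assumes "1 \<le> c"
  shows "Min (set_mset (valuation_mset (c # v))) = 1"
proof (rule Min_eqI)
  show "1 \<le> x" if "x \<in># valuation_mset (c # v)" for x
    using that by (metis atLeastAtMost_iff count_valuation_mset not_in_iff)
  show "1 \<in># valuation_mset (c # v)"
    using assms by (intro count_inI) (simp add: count_valuation_mset letter_def)
qed simp

lemma letter_mem: "i \<in> {1..length v} \<Longrightarrow> letter v i \<in> set v"
  by (auto simp: letter_def)

text \<open>The minimum of \<open>valuation_mset v\<close> is 1, with multiplicity
  \<open>hd v\<close>, so the greedy filling works in all cases but the one described; there, no box
  is left for a second 1. From \<open>n \<noteq> 0\<close> it follows that \<open>v\<close> is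
  nonempty, which gives \<open>hd v\<close> its meaning.\<close>

lemma young_fibonacci_number_eq_0_iff:
  assumes u: "u \<in> snakeshapes n" and v: "v \<in> snakeshapes n" and "n \<noteq> 0"
  shows "young_fibonacci_number u v = 0 \<longleftrightarrow>
    (\<exists>k. u = replicate k 1 @ [2]) \<and> hd v = 2"
proof -
  have sum: "sum_list u = sum_list v" using u v by (simp add: snakeshapes_def)
  obtain c v' where cv: "v = c # v'" using v \<open>n \<noteq> 0\<close> by (cases v) (auto simp: snakeshapes_def)
  \<comment> \<open>Finiteness ensures that cardinality 0 means that no tableau exists.\<close>
  have "young_fibonacci_number u v = 0 \<longleftrightarrow> \<not> (\<exists>T \<in> ssyft u. has_valuation u v T)"
    using finite_tableaux[OF u v] by (auto simp: young_fibonacci_number_def)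
  also have "\<dots> \<longleftrightarrow> (\<exists>k. u = replicate k 1 @ [2]) \<and> hd v = 2"
  proof (cases "(\<exists>k. u = replicate k 1 @ [2]) \<and> hd v = 2")
    case True
    then obtain k where k: "u = replicate k 1 @ [2]" by blast
    have letter_u: "letter u i = (if i = Suc k then 2 else 1)" if "i \<in> {1..Suc k}" for i
      using that by (auto simp: letter_def k nth_append)
    have False if T: "T \<in> ssyft u" and val: "has_valuation u v T" for T
    proof -
      have last: "(Suc k, 1) \<in> boxes u" "(Suc k, 2) \<in> boxes u"
        using letter_u[of "Suc k"] by (auto simp: boxes_def k)
      \<comment> \<open>Since the sizes agree, the prescribed multiplicities exhaust the boxes,
        which excludes the entry 0.\<close>
      have "T (Suc k, 1) \<ge> 1" using valuation_range[OF sum val last(1)] by simp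
      moreover have "T (Suc k, 1) < T (Suc k, 2)"
        using T letter_u[of "Suc k"] by (auto simp: ssyft_def k)
      ultimately have top: "T (Suc k, 2) > 1" by simp
      have "b = (Suc k, 1)" if b: "b \<in> boxes u" "T b = 1" for b
      proof (rule ccontr)
        assume "b \<noteq> (Suc k, 1)"
        obtain i j where ij: "b = (i, j)" by (cases b)
        have i: "i \<in> {1..Suc k}" "j \<in> {1..letter u i}"
          using b by (auto simp: ij boxes_def k)
        show False
        proof (cases "i = Suc k")
          case True
          with i letter_u[of i] \<open>b \<noteq> (Suc k, 1)\<close> have "j = 2" by (auto simp: ij)
          with True b top show False by (simp add: ij)
        next
          case False
          \<comment> \<open>An earlier column has a single box, which is its top box, so by
            condition (2) its entry is at least the last top entry, which exceeds 1.\<close>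
          with i letter_u[of i] have "j = letter u i" "i < Suc k" by auto
          with T last(2) i have "T (i, j) \<ge> T (Suc k, 2)"
            by (fastforce simp: ssyft_def k)
          with b top show False by (simp add: ij)
        qed
      qed
      then have "{b \<in> boxes u. T b = 1} \<subseteq> {(Suc k, 1)}" by blast
      then have "card {b \<in> boxes u. T b = 1} \<le> card {(Suc k, 1::nat)}"
        by (intro card_mono) auto
      moreover have "card {b \<in> boxes u. T b = 1} = 2"
        using val True by (auto simp: has_valuation_def cv letter_def)
      ultimately show False by simp
    qed
    with True show ?thesis by blast
  next
    case False
    have "\<exists>T \<in> ssyft u. content u T = valuation_mset v"
    proof (rule exists_tableau_with_content)
      show "set u \<subseteq> {1, 2}" using u by (simp add: snakeshapes_def)
      show "size (valuation_mset v) = sum_list u" using sum by (simp add: size_valuation_mset)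
      show "count (valuation_mset v) x \<le> 2" for x
        using v letter_mem[of x v] by (auto simp: count_valuation_mset snakeshapes_def)
      fix k assume "u = replicate k 1 @ [2]"
      with False have "hd v \<noteq> 2" by blast
      moreover have "1 \<le> c" using v by (auto simp: cv snakeshapes_def)
      ultimately show "count (valuation_mset v) (Min (set_mset (valuation_mset v))) \<noteq> 2"
        using Min_valuation_mset[of c v'] by (simp add: cv count_valuation_mset letter_def)
    qed
    then obtain T where T: "T \<in> ssyft u" "content u T = valuation_mset v" by blast
    then have "has_valuation u v T"
      by (simp add: has_valuation_def flip: count_content) (simp add: count_valuation_mset)
    with T False show ?thesis by blast
  qed
  finally show ?thesis .
qed

section \<open>Counting the vanishing pairs\<close>

theorem theorem4p4:
  fixes n :: nat
  assumes "n \<ge> 2"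
  shows "card {(u, v). u \<in> snakeshapes n \<and> v \<in> snakeshapes n \<and> young_fibonacci_number u v = 0}
    = fibonacci_number (n - 2)"
proof -
  let ?Z = "{(u, v). u \<in> snakeshapes n \<and> v \<in> snakeshapes n \<and> young_fibonacci_number u v = 0}"
  \<comment> \<open>The shape \<open>u\<close> is forced, with \<open>n - 2\<close> single boxes
    before its last column; only the part \<open>w\<close> of \<open>v\<close> after the initial 2
    is free.\<close>
  let ?h = "\<lambda>w. (replicate (n - 2) (1::nat) @ [2], 2 # w)"
  have "?Z = ?h ` snakeshapes (n - 2)"
  proof (intro equalityI subsetI)
    fix p assume "p \<in> ?Z"
    then obtain u v where p: "p = (u, v)" and u: "u \<in> snakeshapes n" and v: "v \<in> snakeshapes n"
      and "young_fibonacci_number u v = 0" by blast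
    then obtain k where k: "u = replicate k 1 @ [2]" and "hd v = 2"
      using young_fibonacci_number_eq_0_iff[OF u v] assms by auto
    moreover have "k = n - 2" using u by (auto simp: k snakeshapes_def sum_list_replicate)
    moreover obtain w where "v = 2 # w"
      using v \<open>hd v = 2\<close> assms by (cases v) (auto simp: snakeshapes_def)
    moreover have "w \<in> snakeshapes (n - 2)"
      using v by (auto simp: \<open>v = 2 # w\<close> snakeshapes_def)
    ultimately show "p \<in> ?h ` snakeshapes (n - 2)" by (simp add: p)
  next
    fix p assume "p \<in> ?h ` snakeshapes (n - 2)"
    then obtain w where p: "p = ?h w" and w: "w \<in> snakeshapes (n - 2)" by blast
    have u: "replicate (n - 2) 1 @ [2] \<in> snakeshapes n"
      using assms by (auto simp: snakeshapes_def sum_list_replicate)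
    have v: "2 # w \<in> snakeshapes n"
      using assms w by (auto simp: snakeshapes_def)
    have "young_fibonacci_number (replicate (n - 2) 1 @ [2]) (2 # w) = 0"
      using young_fibonacci_number_eq_0_iff[OF u v] assms by auto
    with u v show "p \<in> ?Z" by (simp add: p)
  qed
  moreover have "inj_on ?h (snakeshapes (n - 2))" by (auto simp: inj_on_def)
  ultimately show ?thesis by (simp add: card_image fibonacci_number_def)
qed

end
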